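(* Let $b_1>1$ and $c>0$. The characteristic surface $\mathcal C$, the sonic surface $Son$ and the sonic' surface $Son'$ divide $M\setminus\Pi$ into twelve regions; that is, the complement of $\mathcal C\cup Son\cup Son'$ in $M\setminus\Pi$ has exactly twelve connected components.
   Context: Setting. Let $F=(f,g):\mathbb R^2\to\mathbb R^2$ with $f(u,v)=\frac{v^2}{2}+(b_1+1)\frac{u^2}{2}+a_1u+a_2v$ and $g(u,v)=uv+a_3u+a_4v$, where $a_1,\dots,a_4$ are real constants, $b_1>1$ and $c:=a_3-a_2>0$. For $W=(u,v)$, $W'=(u',v')$ put $U=\frac{u+u'}2$, $V=\frac{v+v'}2$, $X=u-u'$, $Y=v-v'$, $\tilde U=b_1U+a_1-a_4$, $\tilde V=V+a_2$, $V_1=V+a_3=\tilde V+c$. Wave manifold. $M$ is the 3-manifold obtained by blowing up $\{(W,W',s): F(W)-F(W')=s(W-W')\}$ along the diagonal $W=W'$: it is the set of $(U,V,X,Y)$ together with a direction $Z\in\mathbb{RP}^1$ such that $Y=ZX$ and $(1-Z^2)\tilde V-Z\tilde U+c=0$ (suitably homogenized at $Z=\infty$). $\Pi\subset M$ is the plane $Z=0$. On $M\setminus\Pi$ put $z=1/Z$, so $X=zY$ and the equation of $M$ becomes $(z^2-1)V_1-z\tilde U+c=0$. Global coordinates $(t,z,Y)\in\mathbb R^3$ on $M\setminus\Pi$ are given by $$\tilde U=\frac{2cz}{z^2+1}+ct(z^2-1),\qquad V_1=\frac{c}{z^2+1}+ctz .$$ The speed $s$ on $M\setminus\Pi$ is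 $s=U+a_4+zV_1$. A Hugoniot curve is a set $\{u=\text{const},\,v=\text{const}\}$ in $M$, and a Hugoniot' curve is a set $\{u'=\text{const},\,v'=\text{const}\}$ in $M$. Surfaces. The characteristic surface $\mathcal C$ is $\{Y=0\}$. The sonic surface $Son$ is the set of critical points of $s$ restricted to Hugoniot curves; the sonic' surface $Son'$ is the set of critical points of $s$ restricted to Hugoniot' curves. In coordinates $(t,z,Y)$ they are $$Son:\quad -2c\big((b_1+1)z^5+(b_1+4)z^3+3z\big)t-\big((b_1+1)z^4+b_1z^2-1\big)Y-2c\big((b_1-1)z^2+1\big)=0,$$ $$Son':\quad -2c\big((b_1+1)z^5+(b_1+4)z^3+3z\big)t+\big((b_1+1)z^4+b_1z^2-1\big)Y-2c\big((b_1-1)z^2+1\big)=0.$$ *)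

theory Defs
  imports "HOL-Analysis.Analysis"
begin

subsection \<open>The real projective line\<close>

text \<open>
  Points of the projective line are the lines through the origin of the plane; the topology
  is the quotient topology with respect to the span map from the punctured plane.
\<close>

typedef rp1 = "{span {w} | w :: real \<times> real. w \<noteq> 0}"
  morphisms points_of Abs_rp1
  by (auto intro: exI[of _ "(1, 0)"] simp: zero_prod_def)

definition dir :: "real \<times> real \<Rightarrow> rp1" where
  "dir w = Abs_rp1 (span {w})"

instantiation rp1 :: topological_space
begin

definition open_rp1 :: "rp1 set \<Rightarrow> bool" where
  "open_rp1 S \<longleftrightarrow> open {w. w \<noteq> 0 \<and> dir w \<in> S}"

instance
proof
  have "{w :: real \<times> real. w \<noteq> 0 \<and> dir w \<in> UNIV} = - {0}"
    by auto
  then show "open (UNIV :: rp1 set)"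
    by (metis open_rp1_def open_delete open_UNIV Compl_eq_Diff_UNIV)
next
  fix S T :: "rp1 set"
  assume "open S" "open T"
  moreover have "{w. w \<noteq> 0 \<and> dir w \<in> S \<inter> T} =
      {w. w \<noteq> 0 \<and> dir w \<in> S} \<inter> {w. w \<noteq> 0 \<and> dir w \<in> T}"
    by auto
  ultimately show "open (S \<inter> T)"
    by (simp add: open_rp1_def open_Int)
next
  fix K :: "rp1 set set"
  assume "\<forall>S\<in>K. open S"
  moreover have "{w. w \<noteq> 0 \<and> dir w \<in> \<Union>K} = (\<Union>S\<in>K. {w. w \<noteq> 0 \<and> dir w \<in> S})"
    by auto
  ultimately show "open (\<Union>K)"
    by (simp add: open_rp1_def open_UN)
qed

end

lemma points_of_dir: "w \<noteq> 0 \<Longrightarrow> points_of (dir w) = span {w}"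
  unfolding dir_def by (subst Abs_rp1_inverse) blast+

lemma dir_cases: obtains w where "w \<noteq> 0" "L = dir w"
  using points_of[of L] unfolding dir_def by (auto, metis points_of_inverse)

lemma mem_points_of_dir:
  "w \<noteq> 0 \<Longrightarrow> (x, y) \<in> points_of (dir w) \<longleftrightarrow> x * snd w = y * fst w"
proof -
  assume w: "w \<noteq> 0"
  obtain p q where pq: "w = (p, q)" by force
  from w pq have "p \<noteq> 0 \<or> q \<noteq> 0" by (auto simp: zero_prod_def)
  then have "(\<exists>k. x = k * p \<and> y = k * q) \<longleftrightarrow> x * q = y * p"
  proof
    assume "p \<noteq> 0"
    then show ?thesis by (auto simp: field_simps intro!: exI[of _ "x / p"])
  next
    assume "q \<noteq> 0"
    then show ?thesis by (auto simp: field_simps intro!: exI[of _ "y / q"])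
  qed
  then show ?thesis
    unfolding points_of_dir[OF w] span_singleton unfolding pq by (auto simp: image_iff)
qed

lemma dir_eq_iff:
  assumes "w \<noteq> 0" "w' \<noteq> 0"
  shows "dir w = dir w' \<longleftrightarrow> fst w * snd w' = snd w * fst w'"
proof
  assume "dir w = dir w'"
  moreover have "(fst w, snd w) \<in> points_of (dir w)"
    by (subst mem_points_of_dir[OF assms(1)]) (simp add: mult.commute)
  ultimately show "fst w * snd w' = snd w * fst w'"
    using mem_points_of_dir[OF assms(2), of "fst w" "snd w"] by simp
next
  assume e: "fst w * snd w' = snd w * fst w'"
  obtain p q p' q' where pq: "w = (p, q)" "w' = (p', q')" by force
  have n: "p \<noteq> 0 \<or> q \<noteq> 0" "p' \<noteq> 0 \<or> q' \<noteq> 0"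
    using assms pq by (auto simp: zero_prod_def)
  have "x * q = y * p \<longleftrightarrow> x * q' = y * p'" for x y
  proof -
    have e': "p * q' = q * p'" using e pq by simp
    have "q * (x * q' - y * p') = q' * (x * q - y * p)" using e' by algebra
    moreover have "p * (x * q' - y * p') = p' * (x * q - y * p)" using e' by algebra
    ultimately show ?thesis using n by (metis eq_iff_diff_eq_0 mult_eq_0_iff)
  qed
  then have "points_of (dir w) = points_of (dir w')"
    using mem_points_of_dir[OF assms(1)] mem_points_of_dir[OF assms(2)] pq by auto
  then show "dir w = dir w'" by (simp add: points_of_inject)
qed

lemma mem_points_slope: "(x, y) \<in> points_of (dir (z, 1)) \<longleftrightarrow> x = z * y"
  by (subst mem_points_of_dir) (auto simp: zero_prod_def mult.commute)

lemma dir_slope_ne: "dir (z, 1) \<noteq> dir (1, 0)"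
  by (subst dir_eq_iff) (auto simp: zero_prod_def)

lemma dir_slope_cases:
  assumes "L \<noteq> dir (1, 0)"
  obtains z where "L = dir (z, 1)"
proof -
  obtain w where w: "w \<noteq> 0" "L = dir w" by (rule dir_cases)
  with assms have "snd w \<noteq> 0" by (auto simp: dir_eq_iff zero_prod_def)
  with w have "L = dir (fst w / snd w, 1)" by (auto simp: dir_eq_iff zero_prod_def)
  then show thesis by (rule that)
qed

lemma rp1_slope_continuous: "continuous_on {L. L \<noteq> dir (1, 0)} (\<lambda>L. THE z. (z, 1) \<in> points_of L)"
proof -
  let ?f = "\<lambda>L. THE z. (z, 1) \<in> points_of L"
  have fv: "?f (dir w) = fst w / snd w" if "w \<noteq> 0" "snd w \<noteq> 0" for w
    using that by (intro the_equality) (auto simp: mem_points_of_dir field_simps)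
  have ne: "dir w \<noteq> dir (1, 0) \<longleftrightarrow> snd w \<noteq> 0" if "w \<noteq> 0" for w
    using that by (auto simp: dir_eq_iff zero_prod_def)
  have o: "open {L. L \<noteq> dir (1, 0)}"
  proof -
    have "{w :: real \<times> real. w \<noteq> 0 \<and> dir w \<in> {L. L \<noteq> dir (1, 0)}} = {w. snd w \<noteq> 0}"
      using ne by (auto simp: zero_prod_def)
    moreover have "open {w :: real \<times> real. snd w \<noteq> 0}"
      by (intro open_Collect_neq continuous_intros)
    ultimately show ?thesis unfolding open_rp1_def by simp
  qed
  have "open (?f -` B \<inter> {L. L \<noteq> dir (1, 0)})" if "open B" for B
  proof -
    have "{w. w \<noteq> 0 \<and> dir w \<in> ?f -` B \<inter> {L. L \<noteq> dir (1, 0)}} = 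
      (\<lambda>w. fst w / snd w) -` B \<inter> {w :: real \<times> real. snd w \<noteq> 0}"
      using ne fv by (auto simp: zero_prod_def)
    moreover have "open ((\<lambda>w. fst w / snd w) -` B \<inter> {w :: real \<times> real. snd w \<noteq> 0})"
    proof -
      have "open {w :: real \<times> real. snd w \<noteq> 0}"
        by (intro open_Collect_neq continuous_intros)
      moreover have "continuous_on {w :: real \<times> real. snd w \<noteq> 0} (\<lambda>w. fst w / snd w)"
        by (intro continuous_intros) auto
      ultimately show ?thesis using that by (simp add: continuous_on_open_vimage)
    qed
    ultimately show ?thesis unfolding open_rp1_def by simp
  qed
  then show ?thesis using continuous_on_open_vimage[OF o] by blast
qed

lemma dir_continuous: "continuous_on {w. w \<noteq> 0} dir"
proof -
  have o: "open {w :: real \<times> real. w \<noteq> 0}" by (simp add: open_Collect_neq)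
  show ?thesis unfolding continuous_on_open_vimage[OF o]
    by (auto simp: open_rp1_def vimage_def Int_def conj_commute)
qed


subsection \<open>Critical points of a restricted function\<close>

text \<open>
  The set \<open>S\<close> is arbitrary, so criticality is expressed by differentiable curves in \<open>S\<close>.
  This is the usual notion when \<open>S\<close> is a submanifold, as is the case for the
  curves below when \<open>b\<^sub>1 > 1\<close> (there they are graphs over the \<open>z\<close>-axis).
\<close>

definition critical_on :: "('a::real_normed_vector \<Rightarrow> real) \<Rightarrow> 'a set \<Rightarrow> 'a \<Rightarrow> bool" where
  "critical_on f S x \<longleftrightarrow> x \<in> S \<and>
     (\<forall>\<gamma> \<gamma>'. \<gamma> 0 = x \<and> (\<gamma> has_vector_derivative \<gamma>') (at 0) \<and> (\<forall>\<^sub>F \<tau> in nhds 0. \<gamma> \<tau> \<in> S)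
        \<longrightarrow> ((f \<circ> \<gamma>) has_real_derivative 0) (at 0))"


subsection \<open>The wave manifold\<close>

text \<open>A point \<open>(U, V, X, Y, L)\<close>, where the line \<open>L\<close> has slope \<open>Z\<close>.\<close>

type_synonym wpoint = "real \<times> real \<times> real \<times> real \<times> rp1"

fun left_state :: "wpoint \<Rightarrow> real \<times> real" where
  "left_state (U, V, X, Y, L) = (U + X / 2, V + Y / 2)"

fun right_state :: "wpoint \<Rightarrow> real \<times> real" where
  "right_state (U, V, X, Y, L) = (U - X / 2, V - Y / 2)"

locale wave_setting =
  fixes a1 a2 a3 a4 b1 :: real
begin

definition c :: real where
  "c = a3 - a2"

definition flux :: "real \<times> real \<Rightarrow> real \<times> real" where
  "flux = (\<lambda>(u, v). (v\<^sup>2 / 2 + (b1 + 1) * (u\<^sup>2 / 2) + a1 * u + a2 * v,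
                     u * v + a3 * u + a4 * v))"

definition Ut :: "real \<Rightarrow> real" where
  "Ut U = b1 * U + a1 - a4"

definition Vt :: "real \<Rightarrow> real" where
  "Vt V = V + a2"

definition V1 :: "real \<Rightarrow> real" where
  "V1 V = V + a3"

text \<open>
  With \<open>Z = q / p\<close>, the equation \<open>(1 - Z\<^sup>2) Vt - Z Ut + c = 0\<close> is homogenized by multiplying
  with \<open>p\<^sup>2\<close>.
\<close>

definition wave_manifold :: "wpoint set" where
  "wave_manifold = {(U, V, X, Y, L). (X, Y) \<in> points_of L \<and>
     (\<forall>(p, q) \<in> points_of L. (p\<^sup>2 - q\<^sup>2) * Vt V - p * q * Ut U + p\<^sup>2 * c = 0)}"

definition plane_Pi :: "wpoint set" where
  "plane_Pi = {(U, V, X, Y, L). (U, V, X, Y, L) \<in> wave_manifold \<and> L = dir (1, 0)}"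

text \<open>The speed on the complement of \<open>plane_Pi\<close>; there \<open>z = 1 / Z\<close> is the number with \<open>(z, 1) \<in> L\<close>.\<close>

fun speed :: "wpoint \<Rightarrow> real" where
  "speed (U, V, X, Y, L) = U + a4 + (THE z. (z, 1) \<in> points_of L) * V1 V"

text \<open>The inverse of the global coordinate system \<open>(t, z, Y)\<close>; cf. \<open>bij_betw_chart\<close> below.\<close>

definition chart :: "real \<times> real \<times> real \<Rightarrow> wpoint" where
  "chart = (\<lambda>(t, z, Y).
     ((2 * c * z / (z\<^sup>2 + 1) + c * t * (z\<^sup>2 - 1) - a1 + a4) / b1,
      c / (z\<^sup>2 + 1) + c * t * z - a3,
      z * Y, Y, dir (z, 1)))"

definition hugoniot :: "real \<times> real \<Rightarrow> wpoint set" where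
  "hugoniot W = {m \<in> wave_manifold. left_state m = W}"

definition hugoniot' :: "real \<times> real \<Rightarrow> wpoint set" where
  "hugoniot' W' = {m \<in> wave_manifold. right_state m = W'}"

text \<open>
  The three surfaces are taken in the complement of \<open>plane_Pi\<close>, whose smooth structure is the one
  given by the coordinates. Being critical is a local property and the complement is open, so
  pulling back whole Hugoniot curves along \<open>chart\<close> is harmless.
\<close>

definition characteristic_surface :: "wpoint set" where
  "characteristic_surface = {(U, V, X, Y, L). (U, V, X, Y, L) \<in> wave_manifold - plane_Pi \<and> Y = 0}"

definition sonic_surface :: "wpoint set" where
  "sonic_surface =
     chart ` {x. critical_on (speed \<circ> chart) (chart -` hugoniot (left_state (chart x))) x}"

definition sonic_surface' :: "wpoint set" where
  "sonic_surface' =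
     chart ` {x. critical_on (speed \<circ> chart) (chart -` hugoniot' (right_state (chart x))) x}"

end


subsection \<open>Consistency of the definitions\<close>

context wave_setting
begin

lemma mem_wave_manifold_dir:
  assumes "(p, q) \<noteq> 0"
  shows "(U, V, X, Y, dir (p, q)) \<in> wave_manifold \<longleftrightarrow>
    X * q = Y * p \<and> (p\<^sup>2 - q\<^sup>2) * Vt V - p * q * Ut U + p\<^sup>2 * c = 0"
proof -
  have "(\<forall>(p', q') \<in> points_of (dir (p, q)). (p'\<^sup>2 - q'\<^sup>2) * Vt V - p' * q' * Ut U + p'\<^sup>2 * c = 0)
    \<longleftrightarrow> (\<forall>k. k\<^sup>2 * ((p\<^sup>2 - q\<^sup>2) * Vt V - p * q * Ut U + p\<^sup>2 * c) = 0)"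
    unfolding points_of_dir[OF assms] span_singleton
    by (auto simp: power2_eq_square algebra_simps image_iff)
  also have "\<dots> \<longleftrightarrow> (p\<^sup>2 - q\<^sup>2) * Vt V - p * q * Ut U + p\<^sup>2 * c = 0"
    by (metis mult_eq_0_iff one_neq_zero power_one)
  finally show ?thesis
    unfolding wave_manifold_def using mem_points_of_dir[OF assms] by simp
qed

lemma mem_wave_manifold_slope:
  "(U, V, X, Y, dir (z, 1)) \<in> wave_manifold \<longleftrightarrow>
    X = z * Y \<and> (z\<^sup>2 - 1) * V1 V - z * Ut U + c = 0"
  by (subst mem_wave_manifold_dir)
     (auto simp: zero_prod_def V1_def Vt_def c_def algebra_simps)

text \<open>Off the diagonal the manifold consists of the pairs of states satisfying the
  Rankine--Hugoniot condition \<open>F W - F W' = s (W - W')\<close>.\<close>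

lemma rankine_hugoniot:
  assumes "(X, Y) \<noteq> (0, 0)"
  shows "(\<exists>L. (U, V, X, Y, L) \<in> wave_manifold) \<longleftrightarrow>
    (\<exists>s. flux (U + X / 2, V + Y / 2) - flux (U - X / 2, V - Y / 2) = (s * X, s * Y))"
proof -
  have n: "(X, Y) \<noteq> 0" using assms by (simp add: zero_prod_def)
  let ?A = "V * Y + (b1 + 1) * U * X + a1 * X + a2 * Y"
  let ?B = "U * Y + V * X + a3 * X + a4 * Y"
  have "(\<exists>L. (U, V, X, Y, L) \<in> wave_manifold) \<longleftrightarrow> (U, V, X, Y, dir (X, Y)) \<in> wave_manifold"
  proof
    assume "\<exists>L. (U, V, X, Y, L) \<in> wave_manifold"
    then obtain L where L: "(U, V, X, Y, L) \<in> wave_manifold" ..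
    obtain w where w: "w \<noteq> 0" "L = dir w" by (rule dir_cases)
    from L have "(X, Y) \<in> points_of L" by (simp add: wave_manifold_def)
    with w n have "L = dir (X, Y)"
      by (simp add: mem_points_of_dir dir_eq_iff mult.commute)
    with L show "(U, V, X, Y, dir (X, Y)) \<in> wave_manifold" by simp
  qed auto
  also have "\<dots> \<longleftrightarrow> (X\<^sup>2 - Y\<^sup>2) * Vt V - X * Y * Ut U + X\<^sup>2 * c = 0"
    using n by (simp add: mem_wave_manifold_dir mult.commute)
  also have "\<dots> \<longleftrightarrow> ?A * Y = ?B * X"
    unfolding Vt_def Ut_def c_def by (auto simp: power2_eq_square algebra_simps)
  also have "\<dots> \<longleftrightarrow> (\<exists>s. ?A = s * X \<and> ?B = s * Y)"
  proof
    assume e: "?A * Y = ?B * X"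
    show "\<exists>s. ?A = s * X \<and> ?B = s * Y"
    proof (cases "X = 0")
      case True
      with assms have "Y \<noteq> 0" by simp
      with e True show ?thesis by (intro exI[of _ "?B / Y"]) auto
    next
      case False
      with e show ?thesis by (intro exI[of _ "?A / X"]) (simp add: field_simps)
    qed
  next
    assume "\<exists>s. ?A = s * X \<and> ?B = s * Y"
    then obtain s where "?A = s * X" "?B = s * Y" by blast
    then show "?A * Y = ?B * X" by simp
  qed
  also have "\<dots> \<longleftrightarrow> (\<exists>s. flux (U + X / 2, V + Y / 2) - flux (U - X / 2, V - Y / 2) = (s * X, s * Y))"
  proof -
    have "flux (U + X / 2, V + Y / 2) - flux (U - X / 2, V - Y / 2) = (?A, ?B)"
      unfolding flux_def by (simp add: power2_eq_square field_simps)
    then show ?thesis by simp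
  qed
  finally show ?thesis .
qed

lemma speed_slope: "speed (U, V, X, Y, dir (z, 1)) = U + a4 + z * V1 V"
  by (simp add: mem_points_slope)

lemma speed_flux:
  assumes "(U, V, X, Y, L) \<in> wave_manifold - plane_Pi"
  shows "flux (U + X / 2, V + Y / 2) - flux (U - X / 2, V - Y / 2) =
    speed (U, V, X, Y, L) *\<^sub>R (X, Y)"
proof -
  from assms have "L \<noteq> dir (1, 0)" by (auto simp: plane_Pi_def)
  then obtain z where L: "L = dir (z, 1)" by (rule dir_slope_cases)
  with assms have e: "X = z * Y" "(z\<^sup>2 - 1) * V1 V - z * Ut U + c = 0"
    by (auto simp: mem_wave_manifold_slope)
  have "V * Y + (b1 + 1) * U * X + a1 * X + a2 * Y = (U + a4 + z * V1 V) * X"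
    using e unfolding V1_def Ut_def c_def by algebra
  moreover have "U * Y + V * X + a3 * X + a4 * Y = (U + a4 + z * V1 V) * Y"
    using e unfolding V1_def Ut_def c_def by algebra
  ultimately show ?thesis
    unfolding L speed_slope flux_def by (simp add: power2_eq_square field_simps)
qed

lemma chart_in: 
  assumes "b1 > 1" 
  shows "chart x \<in> wave_manifold - plane_Pi"
proof -
  obtain t z Y where x: "x = (t, z, Y)" by (metis prod.exhaust)
  have n: "z\<^sup>2 + 1 \<noteq> 0" by (smt (verit) zero_le_power2)
  define r where "r = 1 / (z\<^sup>2 + 1)"
  have r: "r * (z\<^sup>2 + 1) = 1" using n by (simp add: r_def)
  have "(z\<^sup>2 - 1) * (c * r + c * t * z) - z * (2 * c * z * r + c * t * (z\<^sup>2 - 1)) + c = 0"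
    using r by algebra
  then show ?thesis
    unfolding x chart_def using assms
    by (simp add: mem_wave_manifold_slope plane_Pi_def dir_slope_ne V1_def Ut_def r_def)
qed

lemma bij_betw_chart:
  assumes "b1 > 1" "c > 0"
  shows "bij_betw chart UNIV (wave_manifold - plane_Pi)"
proof (rule bij_betwI')
  fix x x' :: "real \<times> real \<times> real"
  obtain t z Y t' z' Y' where x: "x = (t, z, Y)" "x' = (t', z', Y')" by (metis prod.exhaust)
  show "chart x = chart x' \<longleftrightarrow> x = x'"
  proof
    assume "chart x = chart x'"
    then have e: "z = z'" "Y = Y'" "c * t * (z\<^sup>2 - 1) = c * t' * (z\<^sup>2 - 1)" "c * t * z = c * t' * z"
      using assms(1) unfolding x chart_def by (auto simp: dir_eq_iff zero_prod_def)
    then show "x = x'"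
      using assms(2) unfolding x by (cases "z = 0") auto
  qed simp
next
  fix x show "chart x \<in> wave_manifold - plane_Pi" using assms(1) by (rule chart_in)
next
  fix m assume m: "m \<in> wave_manifold - plane_Pi"
  obtain U V X Y L where UV: "m = (U, V, X, Y, L)" by (metis prod.exhaust)
  from m UV have "L \<noteq> dir (1, 0)" by (auto simp: plane_Pi_def)
  then obtain z where L: "L = dir (z, 1)" by (rule dir_slope_cases)
  with m UV have e: "X = z * Y" "(z\<^sup>2 - 1) * V1 V - z * Ut U + c = 0"
    by (auto simp: mem_wave_manifold_slope)
  have n: "z\<^sup>2 + 1 > 0" by (smt (verit) zero_le_power2)
  define k where "k = 1 / (z\<^sup>2 + 1)"
  have k: "k * (z\<^sup>2 + 1) = 1" using n by (simp add: k_def)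
  define A where "A = Ut U - 2 * c * z * k"
  define B where "B = V1 V - c * k"
  have AB: "(z\<^sup>2 - 1) * B = z * A"
    using e(2) k unfolding A_def B_def by algebra
  obtain r where r: "A = r * (z\<^sup>2 - 1)" "B = r * z"
  proof (cases "z = 0")
    case True with AB have "B = 0" by simp
    with True show ?thesis by (intro that[of "- A"]) auto
  next
    case False with AB show ?thesis by (intro that[of "B / z"]) (auto simp: field_simps)
  qed
  have "Ut U = 2 * c * z / (z\<^sup>2 + 1) + c * (r / c) * (z\<^sup>2 - 1)"
    using r(1) assms(2) unfolding A_def k_def by simp
  moreover have "V1 V = c / (z\<^sup>2 + 1) + c * (r / c) * z"
    using r(2) assms(2) unfolding B_def k_def by simp
  ultimately have "m = chart (r / c, z, Y)"
    using assms(1) unfolding UV L chart_def e(1) Ut_def V1_def by (simp add: field_simps)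
  then show "\<exists>x\<in>UNIV. m = chart x" by blast
qed


text \<open>
  Auxiliary: the Hugoniot (\<open>e = 1\<close>) and Hugoniot' (\<open>e = -1\<close>) curves in coordinates, and the
  corresponding sonic polynomials.
\<close>

definition hug :: "real \<Rightarrow> real \<Rightarrow> real \<Rightarrow> (real \<times> real \<times> real) set" where
  "hug e u v = {(t, z, Y). case chart (t, z, Y) of (U, V, X, Y', L) \<Rightarrow> U + e * X / 2 = u \<and> V + e * Y' / 2 = v}"

definition son_poly :: "real \<Rightarrow> real \<Rightarrow> real \<Rightarrow> real \<Rightarrow> real" where
  "son_poly e t z Y = -2 * c * ((b1+1)*z^5 + (b1+4)*z^3 + 3*z) * t
     - e * ((b1+1)*z^4 + b1*z^2 - 1) * Y - 2 * c * ((b1-1)*z^2 + 1)"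

lemma critical_hug:
  assumes b: "b1 > 1" and c: "c > 0" and e: "e * e = 1" and p: "(t0, z0, Y0) \<in> hug e u v"
  shows "critical_on (speed \<circ> chart) (hug e u v) (t0, z0, Y0) \<longleftrightarrow> son_poly e t0 z0 Y0 = 0"
proof -
  define P where "P = v + a3"
  define Q where "Q = b1 * u + a1 - a4"
  define N where "N = (\<lambda>z. (z\<^sup>2 - 1) * P - z * Q + c)"
  define D where "D = (\<lambda>z. (b1 - 1) * z\<^sup>2 + 1)"
  define h where "h = (\<lambda>z. - 2 * N z / D z)" \<comment> \<open>equals \<open>e * Y\<close>\<close>
  define \<sigma> where "\<sigma> = (\<lambda>z. u + a4 + z * P - z * h z)"
  have D: "D z > 0" for z using b unfolding D_def by (smt (verit) mult_nonneg_nonneg zero_le_power2)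
  have n: "z\<^sup>2 + 1 > 0" for z :: real by (smt (verit) zero_le_power2)
  have n2: "(z\<^sup>2 - 1)\<^sup>2 + z\<^sup>2 > 0" for z :: real
    by (smt (verit) power2_eq_square zero_le_power2 mult_eq_0_iff power_zero_numeral)
  define tt where "tt = (\<lambda>z. ((z\<^sup>2 - 1) * (Q - b1 * z * h z / 2 - 2 * c * z / (z\<^sup>2 + 1))
       + z * (P - h z / 2 - c / (z\<^sup>2 + 1))) / (c * ((z\<^sup>2 - 1)\<^sup>2 + z\<^sup>2)))"
  have mem: "(t, z, Y) \<in> hug e u v \<longleftrightarrow>
     2 * c * z / (z\<^sup>2 + 1) + c * t * (z\<^sup>2 - 1) + b1 * e * z * Y / 2 = Q \<and>
     c / (z\<^sup>2 + 1) + c * t * z + e * Y / 2 = P" for t z Y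
  proof -
    have "(2 * c * z / (z\<^sup>2 + 1) + c * t * (z\<^sup>2 - 1) - a1 + a4) / b1 + e * (z * Y) / 2 = u \<longleftrightarrow>
      2 * c * z / (z\<^sup>2 + 1) + c * t * (z\<^sup>2 - 1) + b1 * e * z * Y / 2 = Q"
    proof -
      have "(W - a1 + a4) / b1 + e * (z * Y) / 2 = u \<longleftrightarrow> W + b1 * e * z * Y / 2 = Q" for W
        using b unfolding Q_def by (auto simp: field_simps)
      then show ?thesis .
    qed
    then show ?thesis unfolding hug_def chart_def P_def by auto
  qed
  have mem2: "(t, z, Y) \<in> hug e u v \<Longrightarrow> e * Y = h z" for t z Y
  proof -
    assume a: "(t, z, Y) \<in> hug e u v"
    define r where "r = 1 / (z\<^sup>2 + 1)"
    have r: "r * (z\<^sup>2 + 1) = 1" using n[of z] by (simp add: r_def)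
    have "2 * c * z * r + c * t * (z\<^sup>2 - 1) + b1 * e * z * Y / 2 = Q"
      "c * r + c * t * z + e * Y / 2 = P" using a unfolding mem r_def by auto
    moreover have "(z\<^sup>2 - 1) * (c * r + c * t * z) - z * (2 * c * z * r + c * t * (z\<^sup>2 - 1)) + c = 0"
      using r by algebra
    ultimately have "(z\<^sup>2 - 1) * (P - e * Y / 2) - z * (Q - b1 * e * z * Y / 2) + c = 0"
      by (metis add_diff_cancel_right')
    then have "e * Y * D z = - 2 * N z"
      unfolding N_def D_def by (simp add: field_simps power2_eq_square)
    then show ?thesis using D[of z] unfolding h_def by (simp add: field_simps)
  qed
  have mem3: "(tt z, z, e * h z) \<in> hug e u v" for z
  proof -
    define r where "r = 1 / (z\<^sup>2 + 1)"
    have r: "r * (z\<^sup>2 + 1) = 1" using n[of z] by (simp add: r_def)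
    have h: "h z * D z = - 2 * N z" using D[of z] unfolding h_def by (simp add: field_simps)
    define A where "A = Q - b1 * z * h z / 2 - 2 * c * z * r"
    define B where "B = P - h z / 2 - c * r"
    have AB: "(z\<^sup>2 - 1) * B = z * A" using h r unfolding A_def B_def N_def D_def by algebra
    have ct: "c * tt z * ((z\<^sup>2 - 1)\<^sup>2 + z\<^sup>2) = (z\<^sup>2 - 1) * A + z * B"
    proof -
      have "tt z = ((z\<^sup>2 - 1) * A + z * B) / (c * ((z\<^sup>2 - 1)\<^sup>2 + z\<^sup>2))"
        unfolding tt_def A_def B_def r_def by simp
      moreover have "c * ((z\<^sup>2 - 1)\<^sup>2 + z\<^sup>2) \<noteq> 0" using mult_pos_pos[OF c n2[of z]] by linarith
      ultimately have "tt z * (c * ((z\<^sup>2 - 1)\<^sup>2 + z\<^sup>2)) = (z\<^sup>2 - 1) * A + z * B"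
        by (metis nonzero_eq_divide_eq)
      then show ?thesis by algebra
    qed
    have "((z\<^sup>2 - 1)\<^sup>2 + z\<^sup>2) * (c * tt z * (z\<^sup>2 - 1) - A) = 0"
      "((z\<^sup>2 - 1)\<^sup>2 + z\<^sup>2) * (c * tt z * z - B) = 0"
      using ct AB by algebra+
    then have "c * tt z * (z\<^sup>2 - 1) = A" "c * tt z * z = B" using n2[of z] by auto
    moreover have "e * (e * h z) = h z" using e by algebra
    moreover have "b1 * e * z * (e * h z) = b1 * z * h z" using e by algebra
    ultimately show ?thesis unfolding mem A_def B_def r_def by simp
  qed
  have sp: "(speed \<circ> chart) (t, z, Y) = \<sigma> z" if "(t, z, Y) \<in> hug e u v" for t z Y
  proof -
    obtain U V where ch: "chart (t, z, Y) = (U, V, z * Y, Y, dir (z, 1))" by (simp add: chart_def)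
    with that have "u = U + z * (e * Y) / 2" "v = V + e * Y / 2"
      unfolding hug_def by (auto simp: mult.left_commute)
    then have "u = U + z * h z / 2" "v = V + h z / 2" using mem2[OF that] by auto
    then show ?thesis unfolding comp_def ch speed_slope \<sigma>_def P_def V1_def
      by (simp only:) (simp add: field_simps)
  qed
  define N' where "N' = 2 * z0 * P - Q"
  define D' where "D' = 2 * (b1 - 1) * z0"
  define h' where "h' = - (2 * N' + h z0 * D') / D z0"
  have dN: "(N has_real_derivative N') (at z0)"
    unfolding N_def N'_def by (auto intro!: derivative_eq_intros)
  have dD: "(D has_real_derivative D') (at z0)"
    unfolding D_def D'_def by (auto intro!: derivative_eq_intros)
  have dh: "(h has_real_derivative h') (at z0)"
  proof -
    have "(h has_real_derivative (- 2 * N' * D z0 - (- 2 * N z0) * D') / (D z0 * D z0)) (at z0)"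
      unfolding h_def using D[of z0] by (intro DERIV_divide DERIV_cmult dN dD) auto
    moreover have "(- 2 * N' * D z0 - (- 2 * N z0) * D') / (D z0 * D z0) = h'"
      using D[of z0] unfolding h'_def h_def by (simp add: field_simps)
    ultimately show ?thesis by simp
  qed
  define s' where "s' = P - h z0 - z0 * h'"
  have d\<sigma>: "(\<sigma> has_real_derivative s') (at z0)"
    unfolding \<sigma>_def s'_def by (auto intro!: derivative_eq_intros dh)
  have poly: "son_poly e t0 z0 Y0 = 0 \<longleftrightarrow> s' = 0"
  proof -
    define r where "r = 1 / (z0\<^sup>2 + 1)"
    have r: "r * (z0\<^sup>2 + 1) = 1" using n[of z0] by (simp add: r_def)
    define k where "k = h z0 / 2"
    have k: "h z0 = 2 * k" "e * Y0 = 2 * k" using mem2[OF p] by (simp_all add: k_def)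
    then have k': "b1 * e * z0 * Y0 = 2 * (b1 * z0 * k)" by algebra
    have Q: "2 * c * z0 * r + c * t0 * (z0\<^sup>2 - 1) + b1 * k * z0 = Q"
      and P: "c * r + c * t0 * z0 + k = P"
      using p unfolding mem r_def k k' by (simp_all add: mult_ac)
    have h': "D z0 * h' = - (2 * N' + h z0 * D')" using D[of z0] by (simp add: h'_def)
    have s': "D z0 * s' = D z0 * (P - h z0) + z0 * (2 * N' + h z0 * D')"
      unfolding s'_def using h' by algebra
    have "son_poly e t0 z0 Y0 = -2 * c * ((b1+1)*z0^5 + (b1+4)*z0^3 + 3*z0) * t0
     - ((b1+1)*z0^4 + b1*z0^2 - 1) * h z0 - 2 * c * ((b1-1)*z0^2 + 1)"
      unfolding son_poly_def mem2[OF p, symmetric] by (simp add: algebra_simps)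
    also have "\<dots> = - 2 * (z0\<^sup>2 + 1) * (D z0 * s')"
      unfolding s' unfolding N'_def D'_def D_def P[symmetric] Q[symmetric] k(1) using r by algebra
    finally show ?thesis using D[of z0] n[of z0] by simp
  qed
  show ?thesis
  proof
    assume L: "critical_on (speed \<circ> chart) (hug e u v) (t0, z0, Y0)"
    define \<gamma> where "\<gamma> = (\<lambda>\<tau>. (tt (z0 + \<tau>), z0 + \<tau>, e * h (z0 + \<tau>)))"
    have "e * h z0 = Y0" using mem2[OF p] e by (metis mult.assoc mult_1)
    moreover have "tt z0 = t0"
    proof -
      have "c * tt z0 * (z0\<^sup>2 - 1) = c * t0 * (z0\<^sup>2 - 1)" "c * tt z0 * z0 = c * t0 * z0"
        using p mem3[of z0] \<open>e * h z0 = Y0\<close> unfolding mem by auto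
      then show ?thesis using c by (cases "z0 = 0") auto
    qed
    ultimately have g0: "\<gamma> 0 = (t0, z0, Y0)" by (simp add: \<gamma>_def)
    have hd: "h differentiable at z0" using dh real_differentiable_def by blast
    have n2': "c * ((z0\<^sup>2 - 1)\<^sup>2 + z0\<^sup>2) \<noteq> 0" using mult_pos_pos[OF c n2[of z0]] by linarith
    have n1': "z0\<^sup>2 + 1 \<noteq> 0" using n[of z0] by simp
    have "tt differentiable at z0"
      unfolding tt_def using hd n2' n1' by (intro derivative_intros) auto
    then obtain t' where dt: "(tt has_real_derivative t') (at z0)"
      using real_differentiable_def by blast
    have "(\<gamma> has_vector_derivative (t', 1, e * h')) (at 0)"
      unfolding \<gamma>_def
      using DERIV_shift[of tt t' 0 z0] DERIV_shift[of h h' 0 z0] dt dh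
      by (auto intro!: has_vector_derivative_Pair derivative_eq_intros
          simp: has_real_derivative_iff_has_vector_derivative[symmetric] add.commute)
    moreover have "\<forall>\<^sub>F \<tau> in nhds 0. \<gamma> \<tau> \<in> hug e u v"
      unfolding \<gamma>_def by (intro always_eventually allI mem3)
    ultimately have "((speed \<circ> chart \<circ> \<gamma>) has_real_derivative 0) (at 0)"
      using L g0 unfolding critical_on_def by blast
    moreover have "speed \<circ> chart \<circ> \<gamma> = (\<lambda>\<tau>. \<sigma> (\<tau> + z0))"
      using sp[OF mem3] unfolding \<gamma>_def by (auto simp: add.commute)
    ultimately have "((\<lambda>\<tau>. \<sigma> (\<tau> + z0)) has_real_derivative 0) (at 0)" by simp
    then have "(\<sigma> has_real_derivative 0) (at z0)" using DERIV_shift[of \<sigma> 0 0 z0] by simp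
    with d\<sigma> have "s' = 0" using DERIV_unique by blast
    then show "son_poly e t0 z0 Y0 = 0" using poly by simp
  next
    assume "son_poly e t0 z0 Y0 = 0"
    then have d0: "(\<sigma> has_real_derivative 0) (at z0)" using d\<sigma> poly by simp
    show "critical_on (speed \<circ> chart) (hug e u v) (t0, z0, Y0)"
      unfolding critical_on_def
    proof (intro conjI p allI impI, elim conjE)
      fix \<gamma> \<gamma>' assume g: "\<gamma> 0 = (t0, z0, Y0)" "(\<gamma> has_vector_derivative \<gamma>') (at 0)"
        "\<forall>\<^sub>F \<tau> in nhds 0. \<gamma> \<tau> \<in> hug e u v"
      define \<zeta> where "\<zeta> = (\<lambda>\<tau>. fst (snd (\<gamma> \<tau>)))"
      have "(\<zeta> has_vector_derivative fst (snd \<gamma>')) (at 0)"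
        unfolding \<zeta>_def using g(2)
        unfolding has_vector_derivative_def by (auto intro!: derivative_eq_intros)
      then have dz: "(\<zeta> has_real_derivative fst (snd \<gamma>')) (at 0)"
        by (simp add: has_real_derivative_iff_has_vector_derivative)
      have "\<zeta> 0 = z0" by (simp add: \<zeta>_def g(1))
      then have "((\<lambda>\<tau>. \<sigma> (\<zeta> \<tau>)) has_real_derivative 0) (at 0)"
        using DERIV_chain2[of \<sigma> 0 \<zeta> 0] d0 dz by simp
      moreover have "\<forall>\<^sub>F \<tau> in nhds 0. (speed \<circ> chart \<circ> \<gamma>) \<tau> = \<sigma> (\<zeta> \<tau>)"
        using g(3)
      proof eventually_elim
        case (elim \<tau>)
        then show ?case using sp[of "fst (\<gamma> \<tau>)" "fst (snd (\<gamma> \<tau>))" "snd (snd (\<gamma> \<tau>))"]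
          by (simp add: \<zeta>_def)
      qed
      ultimately show "((speed \<circ> chart \<circ> \<gamma>) has_real_derivative 0) (at 0)"
        using DERIV_cong_ev[OF refl _ refl, of "speed \<circ> chart \<circ> \<gamma>" "\<lambda>\<tau>. \<sigma> (\<zeta> \<tau>)" 0 0] by simp
    qed
  qed
qed

lemma sonic_surface_eq:
  assumes b: "b1 > 1" and c: "c > 0"
  shows "sonic_surface = chart ` {(t, z, Y).
    - 2 * c * ((b1 + 1) * z ^ 5 + (b1 + 4) * z ^ 3 + 3 * z) * t
    - ((b1 + 1) * z ^ 4 + b1 * z ^ 2 - 1) * Y - 2 * c * ((b1 - 1) * z ^ 2 + 1) = 0}"
proof -
  have "critical_on (speed \<circ> chart) (chart -` hugoniot (left_state (chart (t, z, Y)))) (t, z, Y)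
     \<longleftrightarrow> son_poly 1 t z Y = 0" for t z Y
  proof -
    obtain u v where uv: "left_state (chart (t, z, Y)) = (u, v)" by force
    have eq: "chart -` hugoniot (u, v) = hug 1 u v"
    proof (rule set_eqI)
      fix x
      obtain U V X Y' L where "chart x = (U, V, X, Y', L)" by (metis prod.exhaust)
      with chart_in[OF b, of x] show "x \<in> chart -` hugoniot (u, v) \<longleftrightarrow> x \<in> hug 1 u v"
        by (cases x) (simp add: hugoniot_def hug_def)
    qed
    have "(t, z, Y) \<in> hug 1 u v"
      using uv unfolding hug_def by (simp add: chart_def)
    then show ?thesis unfolding uv eq using critical_hug[OF b c, of 1] by simp
  qed
  then show ?thesis unfolding sonic_surface_def son_poly_def by (intro arg_cong[where f = "image chart"]) auto
qed

lemma sonic_surface'_eq: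
  assumes b: "b1 > 1" and c: "c > 0"
  shows "sonic_surface' = chart ` {(t, z, Y).
    - 2 * c * ((b1 + 1) * z ^ 5 + (b1 + 4) * z ^ 3 + 3 * z) * t
    + ((b1 + 1) * z ^ 4 + b1 * z ^ 2 - 1) * Y - 2 * c * ((b1 - 1) * z ^ 2 + 1) = 0}"
proof -
  have "critical_on (speed \<circ> chart) (chart -` hugoniot' (right_state (chart (t, z, Y)))) (t, z, Y)
     \<longleftrightarrow> son_poly (-1) t z Y = 0" for t z Y
  proof -
    obtain u v where uv: "right_state (chart (t, z, Y)) = (u, v)" by force
    have eq: "chart -` hugoniot' (u, v) = hug (-1) u v"
    proof (rule set_eqI)
      fix x
      obtain U V X Y' L where "chart x = (U, V, X, Y', L)" by (metis prod.exhaust)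
      with chart_in[OF b, of x] show "x \<in> chart -` hugoniot' (u, v) \<longleftrightarrow> x \<in> hug (-1) u v"
        by (cases x) (simp add: hugoniot'_def hug_def)
    qed
    have "(t, z, Y) \<in> hug (-1) u v"
      using uv unfolding hug_def by (simp add: chart_def)
    then show ?thesis unfolding uv eq using critical_hug[OF b c, of "-1"] by simp
  qed
  then show ?thesis unfolding sonic_surface'_def son_poly_def by (intro arg_cong[where f = "image chart"]) (auto simp: algebra_simps)
qed

end

end

theory Submission
  imports Defs
begin

text \<open>
  In the coordinates \<open>(t, z, Y)\<close> both sonic surfaces have the form \<open>A \<plusminus> q(z) Y = 0\<close> with
  \<open>A = p(z) t + r(z)\<close>, where \<open>p(z)\<close> has the sign of \<open>z\<close>, \<open>r > 0\<close>, and \<open>q(z)\<close> has the sign of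
  \<open>(b\<^sub>1 + 1) z\<^sup>2 - 1\<close>. On either side of \<open>Y = 0\<close>, fix the signs of \<open>A + q \<bar>Y\<bar>\<close> and
  \<open>A - q \<bar>Y\<bar>\<close>. Every slice \<open>z = const\<close> of such a sign region is convex, so its components
  correspond to those of its projection to the \<open>z\<close>-axis: the whole line for \<open>(+, +)\<close>, the
  interval \<open>q < 0\<close> for \<open>(-, +)\<close>, the two half-lines \<open>q > 0\<close> for \<open>(+, -)\<close>, and the two half-lines
  \<open>z \<noteq> 0\<close> for \<open>(-, -)\<close>. This makes six components on each side.
\<close>

section \<open>General topology: counting components, connectedness via slices\<close>

text \<open>The complement of each piece in \<open>S\<close> is a union of other open pieces, so
  each piece is clopen in \<open>S\<close>. A connected clopen piece is the component of each of its
  points.\<close>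

lemma card_components_open_partition:
  fixes R :: "'i \<Rightarrow> 'a::topological_space set"
  assumes S: "S = (\<Union>i\<in>I. R i)"
    and op: "\<And>i. i \<in> I \<Longrightarrow> openin (top_of_set S) (R i)"
    and co: "\<And>i. i \<in> I \<Longrightarrow> connected (R i)"
    and ne: "\<And>i. i \<in> I \<Longrightarrow> R i \<noteq> {}"
    and dj: "disjoint_family_on R I"
  shows "card (components S) = card I"
proof -
  have cc: "connected_component_set S x = R i" if i: "i \<in> I" and x: "x \<in> R i" for i x
  proof
    show "R i \<subseteq> connected_component_set S x"
      using S i x co by (intro connected_component_maximal) auto
    have "openin (top_of_set S) (\<Union>j\<in>I - {i}. R j)"
      using op by (intro openin_Union) auto
    moreover have "S - R i = (\<Union>j\<in>I - {i}. R j)"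
      using S i dj unfolding disjoint_family_on_def by blast
    ultimately have cl: "closedin (top_of_set S) (R i)"
      using S i by (auto simp: closedin_def)
    \<comment> \<open>The trace of \<open>R i\<close> on this connected set is clopen and contains
      \<open>x\<close>, hence is all of it.\<close>
    let ?C = "connected_component_set S x"
    have C: "connected ?C" "?C \<subseteq> S" "x \<in> ?C"
      using S i x by (auto simp: connected_component_subset)
    obtain O' K where "open O'" "R i = S \<inter> O'" "closed K" "R i = S \<inter> K"
      using op[OF i] cl by (auto simp: openin_open closedin_closed)
    moreover from this C(2) have "?C \<inter> R i = ?C \<inter> O'" "?C \<inter> R i = ?C \<inter> K" by blast+
    ultimately have "openin (top_of_set ?C) (?C \<inter> R i)" "closedin (top_of_set ?C) (?C \<inter> R i)"
      by (metis openin_open_Int, metis closedin_closed_Int)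
    then have "?C \<inter> R i = ?C"
      using C(1,3) x unfolding connected_clopen by blast
    then show "?C \<subseteq> R i" by blast
  qed
  have "components S = R ` I"
  proof
    show "components S \<subseteq> R ` I"
      using cc S by (auto simp: components_def)
    show "R ` I \<subseteq> components S"
    proof
      fix T assume "T \<in> R ` I"
      then obtain i where i: "i \<in> I" "T = R i" by blast
      with ne obtain x where "x \<in> R i" by blast
      with i S cc show "T \<in> components S" unfolding components_def by blast
    qed
  qed
  \<comment> \<open>Nonempty disjoint pieces are distinct, so pieces and indices are equally
    many.\<close>
  moreover have "inj_on R I"
    using ne dj unfolding inj_on_def disjoint_family_on_def by (metis inf.idem)
  ultimately show ?thesis by (simp add: card_image)
qed

text \<open>The projection to the z-axis is an open map on \<open>X\<close> with connected fibres,
  and for such maps preimages of connected sets are connected.\<close>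

lemma connected_open_convex_slices:
  fixes X :: "(real \<times> real \<times> real) set"
  assumes X: "open X" and co: "connected ((\<lambda>(t, z, Y). z) ` X)"
    and sl: "\<And>z. convex {(t, Y). (t, z, Y) \<in> X}"
  shows "connected X"
proof -
  let ?f = "\<lambda>(t, z, Y). z :: real"
  have f: "?f = (\<lambda>x. fst (snd x))" by auto
  have op: "open (?f ` C)" if "open C" for C :: "(real \<times> real \<times> real) set"
  proof -
    have "?f ` C = fst ` snd ` C" by (force simp: image_iff)
    with that show ?thesis by (simp add: open_image_fst open_image_snd)
  qed
  have "connected (X \<inter> ?f -` (?f ` X))"
  proof (rule connected_open_monotone_preimage[where S = X and T = "?f ` X"])
    show "continuous_on X ?f" unfolding f by (intro continuous_intros)
    show "openin (top_of_set (?f ` X)) (?f ` C)" if "openin (top_of_set X) C" for C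
    proof -
      from that X have "open C" "C \<subseteq> X" by (auto simp: openin_open_eq)
      then show ?thesis using op[OF X] op[of C] by (intro open_openin_trans image_mono)
    qed
    show "connected (X \<inter> ?f -` {z})" for z
    proof -
      have "X \<inter> ?f -` {z} = (\<lambda>(t, Y). (t, z, Y)) ` {(t, Y). (t, z, Y) \<in> X}"
        by (auto simp: image_iff)
      moreover have "connected ((\<lambda>(t, Y). (t, z, Y)) ` {(t, Y). (t, z, Y) \<in> X})"
        using convex_connected[OF sl[of z]]
        by (intro connected_continuous_image) (auto simp: case_prod_beta intro!: continuous_intros)
      ultimately show ?thesis by simp
    qed
  qed (use co in auto)
  moreover have "X \<inter> ?f -` (?f ` X) = X" by auto
  ultimately show ?thesis by simp
qed

text \<open>An index lists the sign of Y, the signs of A + q|Y| and A - q|Y|, and a side of z = 0.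
  The last entry is 0, meaning no restriction on z, exactly when the third is 1; the patterns with
  third entry -1 split into two components.\<close>

definition sign_regions :: "(real \<times> real \<times> real \<times> real) set" where
  "sign_regions = {1, -1} \<times> {(1, 1, 0), (-1, 1, 0), (1, -1, 1), (1, -1, -1), (-1, -1, 1), (-1, -1, -1)}"

lemma card_sign_regions: "card sign_regions = 12"
  by (simp add: sign_regions_def card_cartesian_product)

context wave_setting
begin

section \<open>The coordinates as a homeomorphism\<close>

text \<open>Bijectivity alone does not transport components; continuity in both directions makes
  open and connected sets correspond.\<close>

lemma chart_homeomorphism:
  assumes "b1 > 1" "c > 0"
  shows "\<exists>g. homeomorphism UNIV (wave_manifold - plane_Pi) chart g"
proof -
  define Z :: "rp1 \<Rightarrow> real" where "Z = (\<lambda>L. THE z. (z, 1) \<in> points_of L)"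
  \<comment> \<open>On the manifold, \<open>Ut U\<close> and \<open>V1 V\<close> minus their values
    at t = 0 form the vector ct(z^2 - 1, z). Its scalar product with (z^2 - 1, z), divided by c
    times the squared length of that never vanishing vector, gives t without a case distinction at z
    = 0.\<close>
  define g where "g = (\<lambda>(U, V, X :: real, Y :: real, L).
    (((Ut U - 2 * c * Z L / ((Z L)\<^sup>2 + 1)) * ((Z L)\<^sup>2 - 1) + (V1 V - c / ((Z L)\<^sup>2 + 1)) * Z L)
       / (c * (((Z L)\<^sup>2 - 1)\<^sup>2 + (Z L)\<^sup>2)), Z L, Y))"
  have n2: "(z\<^sup>2 - 1)\<^sup>2 + z\<^sup>2 \<noteq> 0" for z :: real
    by (auto simp: add_nonneg_eq_0_iff)
  have n1: "z\<^sup>2 + 1 \<noteq> 0" for z :: real by (smt (verit) zero_le_power2)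
  have Z: "Z (dir (z, 1)) = z" for z by (simp add: Z_def mem_points_slope)
  have gc: "g (chart x) = x" for x
  proof -
    obtain t z Y where x: "x = (t, z, Y)" by (metis prod.exhaust)
    have "(c * t * (z\<^sup>2 - 1) * (z\<^sup>2 - 1) + c * t * z * z) / (c * ((z\<^sup>2 - 1)\<^sup>2 + z\<^sup>2))
        = t * (c * ((z\<^sup>2 - 1)\<^sup>2 + z\<^sup>2)) / (c * ((z\<^sup>2 - 1)\<^sup>2 + z\<^sup>2))"
      by (simp add: power2_eq_square algebra_simps)
    also have "\<dots> = t" using assms(2) n2[of z] by simp
    finally show ?thesis
      using assms unfolding x g_def chart_def by (simp add: Z Ut_def V1_def)
  qed
  have img: "chart ` UNIV = wave_manifold - plane_Pi"
    using bij_betw_chart[OF assms] by (simp add: bij_betw_def)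
  have contc: "continuous_on UNIV chart"
  proof -
    have "continuous_on UNIV (\<lambda>x :: real \<times> real \<times> real. dir (fst (snd x), 1))"
      by (rule continuous_on_compose2[OF dir_continuous])
        (auto intro!: continuous_intros simp: zero_prod_def)
    then show ?thesis
      unfolding chart_def case_prod_beta
      using n1 assms by (intro continuous_intros) auto
  qed
  have contg: "continuous_on (wave_manifold - plane_Pi) g"
  proof -
    have "continuous_on (wave_manifold - plane_Pi) (\<lambda>m. Z (snd (snd (snd (snd m)))))"
      unfolding Z_def
      by (rule continuous_on_compose2[OF rp1_slope_continuous])
        (auto intro!: continuous_intros simp: plane_Pi_def)
    then show ?thesis
      unfolding g_def case_prod_beta Ut_def V1_def
      using n1 n2 assms by (intro continuous_intros) auto
  qed
  have "homeomorphism UNIV (wave_manifold - plane_Pi) chart g"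
  proof
    show "g ` (wave_manifold - plane_Pi) \<subseteq> UNIV" by simp
    show "chart (g m) = m" if "m \<in> wave_manifold - plane_Pi" for m
      using that gc unfolding img[symmetric] by auto
  qed (use contc contg img gc in auto)
  then show ?thesis by blast
qed

section \<open>Signs of the coefficients of the sonic equations\<close>

definition son_p :: "real \<Rightarrow> real" where
  "son_p z = 2 * c * ((b1 + 1) * z ^ 5 + (b1 + 4) * z ^ 3 + 3 * z)"

definition son_q :: "real \<Rightarrow> real" where
  "son_q z = (b1 + 1) * z ^ 4 + b1 * z ^ 2 - 1"

definition son_r :: "real \<Rightarrow> real" where
  "son_r z = 2 * c * ((b1 - 1) * z ^ 2 + 1)"

lemma son_r_pos: "b1 > 1 \<Longrightarrow> c > 0 \<Longrightarrow> son_r z > 0"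
  unfolding son_r_def by (intro mult_pos_pos add_nonneg_pos) auto

text \<open>Hence for z \<noteq> 0 the coefficient of t is nonzero, and A takes every real value as
  t varies.\<close>

lemma son_p_sgn:
  assumes "b1 > 1" "c > 0"
  shows "\<exists>k>0. son_p z = z * k"
proof (intro exI conjI)
  show "son_p z = z * (2 * c * ((b1 + 1) * z ^ 4 + (b1 + 4) * z ^ 2 + 3))"
    unfolding son_p_def by algebra
  show "2 * c * ((b1 + 1) * z ^ 4 + (b1 + 4) * z ^ 2 + 3) > 0"
    using assms by (intro mult_pos_pos add_nonneg_pos add_nonneg_nonneg) auto
qed

lemma son_q_factor: "son_q z = ((b1 + 1) * z\<^sup>2 - 1) * (z\<^sup>2 + 1)"
  unfolding son_q_def by algebra

lemma son_q_neg_iff: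
  assumes "b1 > 1"
  shows "son_q z < 0 \<longleftrightarrow> \<bar>z\<bar> < 1 / sqrt (b1 + 1)"
proof -
  have "z\<^sup>2 + 1 > 0" by (smt (verit) zero_le_power2)
  then have "son_q z < 0 \<longleftrightarrow> (b1 + 1) * z\<^sup>2 - 1 < 0"
    unfolding son_q_factor by (simp add: mult_less_0_iff)
  also have "\<dots> \<longleftrightarrow> z\<^sup>2 < 1 / (b1 + 1)" using assms by (simp add: field_simps)
  also have "\<dots> \<longleftrightarrow> sqrt (z\<^sup>2) < sqrt (1 / (b1 + 1))" by (rule real_sqrt_less_iff[symmetric])
  finally show ?thesis by (simp add: real_sqrt_divide)
qed

lemma son_q_pos_iff:
  assumes "b1 > 1"
  shows "son_q z > 0 \<longleftrightarrow> \<bar>z\<bar> > 1 / sqrt (b1 + 1)"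
proof -
  have "z\<^sup>2 + 1 > 0" by (smt (verit) zero_le_power2)
  then have "son_q z > 0 \<longleftrightarrow> (b1 + 1) * z\<^sup>2 - 1 > 0"
    unfolding son_q_factor by (simp add: zero_less_mult_iff)
  also have "\<dots> \<longleftrightarrow> 1 / (b1 + 1) < z\<^sup>2" using assms by (simp add: field_simps)
  also have "\<dots> \<longleftrightarrow> sqrt (1 / (b1 + 1)) < sqrt (z\<^sup>2)" by (rule real_sqrt_less_iff[symmetric])
  finally show ?thesis by (simp add: real_sqrt_divide)
qed

section \<open>The twelve regions in coordinates\<close>

text \<open>For a sign \<epsilon>, the product \<epsilon>Y stands for |Y|. This treats both sides of
  Y = 0 at once while keeping the conditions affine in (t, Y) for fixed z.\<close>

fun region :: "real \<times> real \<times> real \<times> real \<Rightarrow> (real \<times> real \<times> real) set" where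
  "region (\<epsilon>, \<sigma>, \<tau>, \<zeta>) = {(t, z, Y). \<epsilon> * Y > 0
     \<and> \<sigma> * (son_p z * t + son_r z + son_q z * (\<epsilon> * Y)) > 0
     \<and> \<tau> * (son_p z * t + son_r z - son_q z * (\<epsilon> * Y)) > 0
     \<and> (\<zeta> = 0 \<or> \<zeta> * z > 0)}"

lemma region_open: "open (region i)"
proof -
  obtain \<epsilon> \<sigma> \<tau> \<zeta> where i: "i = (\<epsilon>, \<sigma>, \<tau>, \<zeta>)" by (metis prod.exhaust)
  show ?thesis
    unfolding i region.simps case_prod_beta son_p_def son_q_def son_r_def
    by (intro open_Collect_conj open_Collect_disj open_Collect_less open_Collect_const continuous_intros)
qed

lemma region_slice_convex: "convex {(t, Y). (t, z, Y) \<in> region i}"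
proof -
  obtain \<epsilon> \<sigma> \<tau> \<zeta> where i: "i = (\<epsilon>, \<sigma>, \<tau>, \<zeta>)" by (metis prod.exhaust)
  have half: "convex {(t :: real, Y :: real). \<alpha> * t + \<beta> * Y + \<gamma> > 0}" for \<alpha> \<beta> \<gamma>
  proof -
    have "{(t, Y). \<alpha> * t + \<beta> * Y + \<gamma> > 0} = {x. (\<alpha>, \<beta>) \<bullet> x > - \<gamma>}"
      by (auto simp: inner_prod_def)
    then show ?thesis by (simp add: convex_halfspace_gt)
  qed
  have "{(t, Y). (t, z, Y) \<in> region i} =
      {(t, Y). 0 * t + \<epsilon> * Y + 0 > 0}
    \<inter> {(t, Y). (\<sigma> * son_p z) * t + (\<sigma> * son_q z * \<epsilon>) * Y + \<sigma> * son_r z > 0}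
    \<inter> {(t, Y). (\<tau> * son_p z) * t + (- \<tau> * son_q z * \<epsilon>) * Y + \<tau> * son_r z > 0}
    \<inter> {x. \<zeta> = 0 \<or> \<zeta> * z > 0}"
    unfolding i by (auto simp: algebra_simps)
  moreover have "convex {x :: real \<times> real. \<zeta> = 0 \<or> \<zeta> * z > 0}"
    by (cases "\<zeta> = 0 \<or> \<zeta> * z > 0") (simp_all del: disj_not1)
  ultimately show ?thesis by (simp only:) (intro convex_Int half)
qed

lemma region_projection:
  assumes b: "b1 > 1" and c: "c > 0" and i: "i \<in> sign_regions"
  shows "connected ((\<lambda>(t, z, Y). z) ` region i)" and "region i \<noteq> {}"
proof -
  obtain \<epsilon> \<sigma> \<tau> \<zeta> where ie: "i = (\<epsilon>, \<sigma>, \<tau>, \<zeta>)" by (metis prod.exhaust)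
  with i have e: "\<epsilon> * \<epsilon> = 1" by (auto simp: sign_regions_def)
  \<comment> \<open>\<open>B z\<close> says that the slice at z is nonempty; substituting y =
    \<epsilon>Y removes the dependence on \<epsilon>.\<close>
  define B where "B = (\<lambda>z. \<exists>t y. y > 0 \<and> \<sigma> * (son_p z * t + son_r z + son_q z * y) > 0
     \<and> \<tau> * (son_p z * t + son_r z - son_q z * y) > 0 \<and> (\<zeta> = 0 \<or> \<zeta> * z > 0))"
  have B: "(\<lambda>(t, z, Y). z) ` region i = {z. B z}"
  proof (intro set_eqI iffI)
    fix z assume "z \<in> (\<lambda>(t, z, Y). z) ` region i"
    then show "z \<in> {z. B z}" unfolding ie B_def by fastforce
  next
    fix z assume "z \<in> {z. B z}"
    then obtain t y where "y > 0" "\<sigma> * (son_p z * t + son_r z + son_q z * y) > 0"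
     "\<tau> * (son_p z * t + son_r z - son_q z * y) > 0" "\<zeta> = 0 \<or> \<zeta> * z > 0" 
      unfolding B_def by blast
    moreover have "\<epsilon> * (\<epsilon> * y) = y" using e by (metis mult.assoc mult_1)
    ultimately have "(t, z, \<epsilon> * y) \<in> region i" unfolding ie by (simp only: region.simps mem_Collect_eq case_prod_conv)
    then show "z \<in> (\<lambda>(t, z, Y). z) ` region i" by (force simp: image_iff)
  qed
  define k where "k = 1 / sqrt (b1 + 1)"
  have k: "k > 0" using b by (simp add: k_def)
  have r: "son_r z > 0" for z using son_r_pos[OF b c] .
  note q = son_q_neg_iff[OF b, folded k_def] son_q_pos_iff[OF b, folded k_def]
  \<comment> \<open>At t = 0, A equals r. The chosen y gives qy = -2r, so the two forms take the
    values -r and 3r. In \<open>q_pos\<close> below, qy = 2r exchanges these values.\<close>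
  have q_neg: "B z" if "son_q z < 0" "\<sigma> = -1" "\<tau> = 1" "\<zeta> = 0" for z
    unfolding B_def using that r[of z]
    by (intro exI[of _ 0] exI[of _ "2 * son_r z / - son_q z"]) (auto intro!: divide_pos_neg)
  have q_pos: "B z" if "son_q z > 0" "\<sigma> = 1" "\<tau> = -1" "\<zeta> * z > 0" for z
    unfolding B_def using that r[of z]
    by (intro exI[of _ 0] exI[of _ "2 * son_r z / son_q z"]) auto
  \<comment> \<open>Here t solves A = -|q| - 1, so with y = 1 both A + q and A - q are at most
    -1.\<close>
  have p_neg: "B z" if "\<sigma> = -1" "\<tau> = -1" "\<zeta> * z > 0" for z
  proof -
    obtain l where "l > 0" "son_p z = z * l" using son_p_sgn[OF b c] by blast
    with that have "son_p z \<noteq> 0" by auto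
    then show ?thesis
      unfolding B_def using that
      by (intro exI[of _ "- (son_r z + \<bar>son_q z\<bar> + 1) / son_p z"] exI[of _ 1]) auto
  qed
  have pos: "B z" if "\<sigma> = 1" "\<tau> = 1" "\<zeta> = 0" for z
  proof -
    \<comment> \<open>This y is small enough for |qy| < r = A at t = 0; the 1 in the denominator
      covers q = 0.\<close>
    define y where "y = son_r z / (\<bar>son_q z\<bar> + 1)"
    have y: "y > 0" using r[of z] by (simp add: y_def)
    have "y * (\<bar>son_q z\<bar> + 1) = son_r z" by (simp add: y_def)
    then have "\<bar>son_q z * y\<bar> < son_r z" using y by (simp add: abs_mult algebra_simps)
    then show ?thesis unfolding B_def using that y by (intro exI[of _ 0] exI[of _ y]) auto
  qed
  \<comment> \<open>Comparing A + qy < 0 < A - qy gives qy < 0; \<open>B_pos\<close> is the mirror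
    image.\<close>
  have B_neg: "son_q z < 0" if Bz: "B z" and st: "\<sigma> = -1" "\<tau> = 1" for z
  proof -
    obtain t y where "y > 0" "- (son_p z * t + son_r z + son_q z * y) > 0"
      "son_p z * t + son_r z - son_q z * y > 0"
      using Bz unfolding B_def st by auto
    then have "y > 0" "son_q z * y < 0" by linarith+
    then show ?thesis by (simp add: mult_less_0_iff)
  qed
  have B_pos: "son_q z > 0" if Bz: "B z" and st: "\<sigma> = 1" "\<tau> = -1" for z
  proof -
    obtain t y where "y > 0" "son_p z * t + son_r z + son_q z * y > 0"
      "- (son_p z * t + son_r z - son_q z * y) > 0"
      using Bz unfolding B_def st by auto
    then have "y > 0" "son_q z * y > 0" by linarith+
    then show ?thesis by (simp add: zero_less_mult_iff)
  qed
  have \<zeta>: "\<zeta> * z > 0" if "B z" "\<zeta> \<noteq> 0" for z using that by (auto simp: B_def)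
  consider "\<sigma> = 1" "\<tau> = 1" "\<zeta> = 0" | "\<sigma> = -1" "\<tau> = 1" "\<zeta> = 0" | "\<sigma> = 1" "\<tau> = -1" "\<zeta> = 1"
    | "\<sigma> = 1" "\<tau> = -1" "\<zeta> = -1" | "\<sigma> = -1" "\<tau> = -1" "\<zeta> = 1" | "\<sigma> = -1" "\<tau> = -1" "\<zeta> = -1"
    using i unfolding ie sign_regions_def by auto
  then have "connected {z. B z} \<and> {z. B z} \<noteq> {}"
  proof cases
    case 1
    have "{z. B z} = UNIV" using pos[OF 1] by simp
    then show ?thesis by simp
  next
    case 2
    have "B z \<longleftrightarrow> - k < z \<and> z < k" for z
      using q_neg[OF _ 2, of z] B_neg[OF _ 2(1,2), of z] q(1)[of z, unfolded abs_less_iff] by argo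
    then have "{z. B z} = {- k<..<k}" by (simp add: set_eq_iff)
    then show ?thesis using k by simp
  next
    case 3
    \<comment> \<open>The condition q > 0 means |z| > k, and \<zeta> selects one of the two
      half-lines.\<close>
    have "B z \<longleftrightarrow> k < z" for z
    proof
      assume Bz: "B z"
      have "\<zeta> * z > 0" using \<zeta>[OF Bz] 3(3) by simp
      then have "z > 0" using 3(3) by simp
      moreover have "\<bar>z\<bar> > k" using B_pos[OF Bz 3(1,2)] q(2) by simp
      ultimately show "k < z" by linarith
    next
      assume z: "k < z"
      with k have "\<bar>z\<bar> > k" by linarith
      then have "son_q z > 0" using q(2) by simp
      moreover have "\<zeta> * z > 0" using 3(3) k z by simp
      ultimately show "B z" using 3(1,2) by (intro q_pos)
    qed
    then have "{z. B z} = {k<..}" by (simp add: set_eq_iff)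
    then show ?thesis by simp
  next
    case 4
    have "B z \<longleftrightarrow> z < - k" for z
    proof
      assume Bz: "B z"
      have "\<zeta> * z > 0" using \<zeta>[OF Bz] 4(3) by simp
      then have "z < 0" using 4(3) by simp
      moreover have "\<bar>z\<bar> > k" using B_pos[OF Bz 4(1,2)] q(2) by simp
      ultimately show "z < - k" by linarith
    next
      assume z: "z < - k"
      with k have "\<bar>z\<bar> > k" by linarith
      then have "son_q z > 0" using q(2) by simp
      moreover have "\<zeta> * z > 0" using 4(3) k z by simp
      ultimately show "B z" using 4(1,2) by (intro q_pos)
    qed
    then have "{z. B z} = {..<- k}" by (simp add: set_eq_iff)
    then show ?thesis by simp
  next
    case 5
    have "B z \<longleftrightarrow> z > 0" for z
    proof
      assume "B z"
      from \<zeta>[OF this] show "z > 0" using 5(3) by simp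
    next
      assume "z > 0"
      then show "B z" using 5(3) by (intro p_neg[OF 5(1,2)]) simp
    qed
    then have "{z. B z} = {0<..}" by (simp add: set_eq_iff)
    then show ?thesis by simp
  next
    case 6
    have "B z \<longleftrightarrow> z < 0" for z
    proof
      assume "B z"
      from \<zeta>[OF this] show "z < 0" using 6(3) by simp
    next
      assume "z < 0"
      then show "B z" using 6(3) by (intro p_neg[OF 6(1,2)]) simp
    qed
    then have "{z. B z} = {..<0}" by (simp add: set_eq_iff)
    then show ?thesis by simp
  qed
  then show "connected ((\<lambda>(t, z, Y). z) ` region i)" "region i \<noteq> {}"
    unfolding B[symmetric] by blast+
qed

text \<open>A point determines its index: three entries are signs of expressions at the point, and
  the last is 0 or the sign of z according to the third.\<close>

lemma region_disjoint: "disjoint_family_on region sign_regions"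
proof -
  have index: "i = (sgn Y, sgn (son_p z * t + son_r z + son_q z * \<bar>Y\<bar>),
      sgn (son_p z * t + son_r z - son_q z * \<bar>Y\<bar>),
      if son_p z * t + son_r z - son_q z * \<bar>Y\<bar> > 0 then 0 else sgn z)"
    if i: "i \<in> sign_regions" and x: "(t, z, Y) \<in> region i" for i t z Y
  proof -
    obtain \<epsilon> \<sigma> \<tau> \<zeta> where ie: "i = (\<epsilon>, \<sigma>, \<tau>, \<zeta>)" by (metis prod.exhaust)
    have sgn: "\<eta> = sgn a" if "\<eta> = 1 \<or> \<eta> = -1" "\<eta> * a > 0" for \<eta> a :: real
      using that by auto
    have "\<epsilon> = sgn Y" using i x unfolding ie sign_regions_def by (intro sgn) auto
    then have "\<epsilon> * Y = \<bar>Y\<bar>" by (simp add: abs_sgn mult.commute)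
    then have x': "\<sigma> * (son_p z * t + son_r z + son_q z * \<bar>Y\<bar>) > 0"
      "\<tau> * (son_p z * t + son_r z - son_q z * \<bar>Y\<bar>) > 0" "\<zeta> = 0 \<or> \<zeta> * z > 0"
      using x unfolding ie by auto
    have "\<sigma> = sgn (son_p z * t + son_r z + son_q z * \<bar>Y\<bar>)"
      using i x'(1) unfolding ie sign_regions_def by (intro sgn) auto
    moreover have "\<tau> = sgn (son_p z * t + son_r z - son_q z * \<bar>Y\<bar>)"
      using i x'(2) unfolding ie sign_regions_def by (intro sgn) auto
    moreover have "\<zeta> = (if son_p z * t + son_r z - son_q z * \<bar>Y\<bar> > 0 then 0 else sgn z)"
      using i x'(2,3) unfolding ie sign_regions_def by auto
    ultimately show ?thesis unfolding ie using \<open>\<epsilon> = sgn Y\<close> by simp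
  qed
  show ?thesis
    unfolding disjoint_family_on_def
  proof (intro ballI impI)
    fix i j assume ij: "i \<in> sign_regions" "j \<in> sign_regions" "i \<noteq> j"
    show "region i \<inter> region j = {}"
    proof (rule ccontr)
      assume "region i \<inter> region j \<noteq> {}"
      then obtain t z Y where "(t, z, Y) \<in> region i" "(t, z, Y) \<in> region j" by auto
      with index ij show False by metis
    qed
  qed
qed

text \<open>For a point off all three surfaces, the signs at the point supply its index. The only
  points that could be missed are those with z = 0 and third sign -1.\<close>

lemma region_union:
  assumes b: "b1 > 1" and c: "c > 0"
  shows "(\<Union>i\<in>sign_regions. region i) = {(t, z, Y). Y \<noteq> 0
    \<and> son_p z * t + son_r z + son_q z * Y \<noteq> 0 \<and> son_p z * t + son_r z - son_q z * Y \<noteq> 0}"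
    (is "_ = ?R")
proof (intro set_eqI iffI)
  fix x assume "x \<in> (\<Union>i\<in>sign_regions. region i)"
  then show "x \<in> ?R" unfolding sign_regions_def by auto
next
  fix x assume xR: "x \<in> ?R"
  obtain t z Y where x: "x = (t, z, Y)" by (metis prod.exhaust)
  define A where "A = son_p z * t + son_r z"
  \<comment> \<open>At z = 0, p = 0, q = -1 and r = 2c, so the form equals 2c + |Y| > 0.\<close>
  have z: "z \<noteq> 0" if "A - son_q z * \<bar>Y\<bar> < 0"
  proof
    assume "z = 0"
    then show False using that c by (simp add: A_def son_p_def son_q_def son_r_def)
  qed
  define \<epsilon> where "\<epsilon> = sgn Y"
  define \<sigma> where "\<sigma> = sgn (A + son_q z * \<bar>Y\<bar>)"
  define \<tau> where "\<tau> = sgn (A - son_q z * \<bar>Y\<bar>)"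
  define \<zeta> where "\<zeta> = (if \<tau> = 1 then 0 else sgn z)"
  \<comment> \<open>Replacing Y by |Y| at most swaps the two sonic forms.\<close>
  have n: "Y \<noteq> 0" "A + son_q z * \<bar>Y\<bar> \<noteq> 0" "A - son_q z * \<bar>Y\<bar> \<noteq> 0"
    using xR unfolding x A_def by (auto simp: abs_if)
  have m: "(\<epsilon>, \<sigma>, \<tau>, \<zeta>) \<in> sign_regions"
    unfolding sign_regions_def using n z
    by (auto simp: \<epsilon>_def \<sigma>_def \<tau>_def \<zeta>_def sgn_if)
  have "\<epsilon> * Y = \<bar>Y\<bar>" by (simp add: \<epsilon>_def abs_sgn mult.commute)
  then have "x \<in> region (\<epsilon>, \<sigma>, \<tau>, \<zeta>)"
    using n z unfolding x by (auto simp: A_def[symmetric] \<sigma>_def \<tau>_def \<zeta>_def sgn_if split: if_splits)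
  with m show "x \<in> (\<Union>i\<in>sign_regions. region i)" by blast
qed

section \<open>Transfer to the manifold and the count\<close>

text \<open>Reversing the overall sign of the sonic equation makes the constant term the positive
  r.\<close>

lemma sonic_surface_image:
  assumes "b1 > 1" "c > 0"
  shows "sonic_surface = chart ` {(t, z, Y). son_p z * t + son_r z + son_q z * Y = 0}"
proof -
  have "- 2 * c * ((b1 + 1) * z ^ 5 + (b1 + 4) * z ^ 3 + 3 * z) * t
      - ((b1 + 1) * z ^ 4 + b1 * z ^ 2 - 1) * Y - 2 * c * ((b1 - 1) * z ^ 2 + 1)
    = - (son_p z * t + son_r z + son_q z * Y)" for t z Y
    unfolding son_p_def son_q_def son_r_def by algebra
  then show ?thesis
    unfolding sonic_surface_eq[OF assms] by (simp only: neg_equal_0_iff_equal)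
qed

lemma sonic_surface'_image:
  assumes "b1 > 1" "c > 0"
  shows "sonic_surface' = chart ` {(t, z, Y). son_p z * t + son_r z - son_q z * Y = 0}"
proof -
  have "- 2 * c * ((b1 + 1) * z ^ 5 + (b1 + 4) * z ^ 3 + 3 * z) * t
      + ((b1 + 1) * z ^ 4 + b1 * z ^ 2 - 1) * Y - 2 * c * ((b1 - 1) * z ^ 2 + 1)
    = - (son_p z * t + son_r z - son_q z * Y)" for t z Y
    unfolding son_p_def son_q_def son_r_def by algebra
  then show ?thesis
    unfolding sonic_surface'_eq[OF assms] by (simp only: neg_equal_0_iff_equal)
qed

lemma card_components_complement:
  assumes b: "b1 > 1" and c: "c > 0"
  shows "card (components (wave_manifold - plane_Pi
     - (characteristic_surface \<union> sonic_surface \<union> sonic_surface'))) = 12"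
proof -
  let ?M = "wave_manifold - plane_Pi"
  let ?S = "?M - (characteristic_surface \<union> sonic_surface \<union> sonic_surface')"
  obtain g where g: "homeomorphism UNIV ?M chart g"
    using chart_homeomorphism[OF b c] ..
  have inj: "inj chart" and img: "?M = chart ` UNIV"
    using bij_betw_chart[OF b c] by (auto simp: bij_betw_def)
  have ch: "characteristic_surface = chart ` {(t, z, Y). Y = 0}"
  proof -
    have "characteristic_surface = {m \<in> ?M. fst (snd (snd (snd m))) = 0}"
      unfolding characteristic_surface_def by auto
    also have "\<dots> = chart ` {x. fst (snd (snd (snd (chart x)))) = 0}" unfolding img by blast
    also have "{x. fst (snd (snd (snd (chart x)))) = 0} = {(t, z, Y). Y = 0}"
      by (simp add: chart_def case_prod_beta set_eq_iff)
    finally show ?thesis .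
  qed
  \<comment> \<open>Injectivity of \<open>chart\<close> lets images commute with set difference, so
    the complement can be computed in coordinates.\<close>
  have S: "?S = chart ` (\<Union>i\<in>sign_regions. region i)"
    unfolding region_union[OF b c] ch sonic_surface_image[OF b c] sonic_surface'_image[OF b c] img
      image_Un[symmetric] image_set_diff[OF inj, symmetric]
    by (rule arg_cong[where f = "image chart"]) blast
  have "card (components ?S) = card sign_regions"
  proof (rule card_components_open_partition)
    show "?S = (\<Union>i\<in>sign_regions. chart ` region i)" unfolding S by auto
    fix i assume i: "i \<in> sign_regions"
    note J = region_projection[OF b c i]
    from J(2) show "chart ` region i \<noteq> {}" by simp
    have "connected (region i)"
      using J(1) region_open region_slice_convex by (intro connected_open_convex_slices) auto
    moreover have "continuous_on (region i) chart"
      using g unfolding homeomorphism_def by (meson continuous_on_subset subset_UNIV)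
    ultimately show "connected (chart ` region i)" by (intro connected_continuous_image)
    have "openin (top_of_set ?M) (chart ` region i)"
      using homeomorphism_imp_open_map[OF g, of "region i"] region_open by simp
    moreover have "chart ` region i \<subseteq> ?S" using S i by blast
    ultimately show "openin (top_of_set ?S) (chart ` region i)"
      by (rule openin_subset_trans) blast
  next
    show "disjoint_family_on (\<lambda>i. chart ` region i) sign_regions"
      using region_disjoint inj unfolding disjoint_family_on_def
      by (metis image_Int image_empty)
  qed
  then show ?thesis by (simp add: card_sign_regions)
qed

end

theorem proposition1:
  fixes a1 a2 a3 a4 b1 :: real
  assumes "b1 > 1" and "a3 - a2 > 0"
  shows "card (components
    (wave_setting.wave_manifold a1 a2 a3 a4 b1 - wave_setting.plane_Pi a1 a2 a3 a4 b1
     - (wave_setting.characteristic_surface a1 a2 a3 a4 b1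
        \<union> wave_setting.sonic_surface a1 a2 a3 a4 b1
        \<union> wave_setting.sonic_surface' a1 a2 a3 a4 b1))) = 12"
  using wave_setting.card_components_complement[of b1 a2 a3 a1 a4] assms
  unfolding wave_setting.c_def by blast

end
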